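(* Let $I\subset(0,\infty)$ be an interval with interior $I^\circ$, let $f:I\to\mathbb{R}$ be a differentiable function on $I^\circ$, let $m\in(0,1]$, let $a,b/m\in I^\circ$ with $a<b$, and suppose $f'\in L[a,b]$. If $|f'|^q$ is harmonically $(\alpha,m)$-convex on $[a,b/m]$ for $q>1$, $\frac1p+\frac1q=1$, with $\alpha\in[0,1]$, then $$\left|\frac{f(a)+f(b)}{2}-\frac{ab}{b-a}\int_a^b\frac{f(x)}{x^2}\,dx\right|\le\frac{ab(b-a)}{2}\left(\frac1{p+1}\right)^{\frac1p}\Big(\nu(\alpha,q;a,b)|f'(a)|^q+m\big(\nu(0,q;a,b)-\nu(\alpha,q;a,b)\big)|f'(b/m)|^q\Big)^{\frac1q},$$ where $$\nu(\alpha,q;a,b)=\frac{\beta(1,\alpha+1)}{b^{2q}}\,{}_2F_1\left(2q,1;\alpha+2;1-\frac ab\right).$$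
   Context: Definition: a function $g:(0,b^{*}]\to\mathbb{R}$, $b^{*}>0$, is said to be harmonically $(\alpha,m)$-convex, where $\alpha\in[0,1]$ and $m\in(0,1]$, if $$g\left(\frac{mxy}{mty+(1-t)x}\right)=g\left(\left(\frac tx+\frac{1-t}{my}\right)^{-1}\right)\le t^{\alpha}g(x)+m(1-t^{\alpha})g(y)$$ for all $x,y\in(0,b^{*}]$ and $t\in[0,1]$. Being harmonically $(\alpha,m)$-convex on $[a,b/m]$ refers to this same inequality for all $x,y\in[a,b/m]$ and all $t\in[0,1]$. $\beta(x,y)=\frac{\Gamma(x)\Gamma(y)}{\Gamma(x+y)}=\int_0^1t^{x-1}(1-t)^{y-1}dt$ for $x,y>0$ is the Euler Beta function, and ${}_2F_1(A,B;C;z)=\frac{1}{\beta(B,C-B)}\int_0^1t^{B-1}(1-t)^{C-B-1}(1-zt)^{-A}dt$ for $C>B>0$, $|z|<1$ is the hypergeometric function. $L[a,b]$ denotes the integrable functions on $[a,b]$. *)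

theory Defs
  imports "HOL-Analysis.Analysis"
begin

text \<open>Real power with the convention that zero to the power zero is one
  (in contrast to \<^const>\<open>powr\<close>).\<close>
definition rpow :: "real \<Rightarrow> real \<Rightarrow> real" where
  "rpow t \<alpha> = (if \<alpha> = 0 then 1 else t powr \<alpha>)"

text \<open>The argument of \<open>g\<close> on the left-hand side may fall outside \<open>S\<close>, since for \<open>t = 0\<close> it is \<open>m * y\<close>;
  \<open>g\<close> is therefore evaluated at points of a larger set than \<open>S\<close>.\<close>
definition harmonically_convex_on :: "real \<Rightarrow> real \<Rightarrow> real set \<Rightarrow> (real \<Rightarrow> real) \<Rightarrow> bool" where
  "harmonically_convex_on \<alpha> m S g \<longleftrightarrow>
     (\<forall>x\<in>S. \<forall>y\<in>S. \<forall>t\<in>{0..1}.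
        g (m * x * y / (m * t * y + (1 - t) * x))
          \<le> rpow t \<alpha> * g x + m * (1 - rpow t \<alpha>) * g y)"

text \<open>Gauss hypergeometric function by its Euler integral, meaningful for \<open>C > B > 0\<close> and \<open>\<bar>z\<bar> < 1\<close>.\<close>
definition hypergeom_2F1 :: "real \<Rightarrow> real \<Rightarrow> real \<Rightarrow> real \<Rightarrow> real" where
  "hypergeom_2F1 A B C z =
     1 / Beta B (C - B) *
     integral {0..1} (\<lambda>t. t powr (B - 1) * (1 - t) powr (C - B - 1) * (1 - z * t) powr (- A))"

definition nu :: "real \<Rightarrow> real \<Rightarrow> real \<Rightarrow> real \<Rightarrow> real" where
  "nu \<alpha> q a b = Beta 1 (\<alpha> + 1) / b powr (2 * q) * hypergeom_2F1 (2 * q) 1 (\<alpha> + 2) (1 - a / b)"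

end

theory Submission
  imports Defs
begin

text \<open>
  The points \<open>a * b / (a + t * (b - a))\<close> for \<open>t\<close> from \<open>0\<close> to \<open>1\<close> run from \<open>b\<close> down to \<open>a\<close>, linearly
  in the reciprocal. In this parameter the measure \<open>dx / x\<^sup>2\<close> on \<open>[a, b]\<close> is a constant multiple of
  \<open>dt\<close>, so the left-hand side is the error of the trapezoidal rule for \<open>F t = f (a * b / (a + t * (b - a)))\<close>
  on \<open>[0, 1]\<close>. Integrating by parts against \<open>1 - 2 * t\<close> turns that error into an integral of
  \<open>(1 - 2 * t) * f' (a * b / (a + t * (b - a))) / (a + t * (b - a))\<^sup>2\<close>
  (\<open>harmonic_trapezoid_error\<close>).

  Hoelder's inequality, with \<open>1 - 2 * t\<close> as one factor and the rest as the other, gives the constant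
  \<open>1 / (p + 1)\<close> from the first factor. In the second one, harmonic convexity applied to the points
  \<open>a\<close> and \<open>b / m\<close> bounds \<open>\<bar>f'\<bar>\<close> to the power \<open>q\<close> by an explicit function of \<open>t\<close>, and the integrals
  that remain are exactly the weights \<open>nu\<close>: after \<open>t \<mapsto> 1 - t\<close>, the Euler integral of the
  hypergeometric function becomes a moment of \<open>(a + t * (b - a)) powr - (2 * q)\<close>
  (\<open>nu_has_integral\<close>).
\<close>

section \<open>A Hoelder inequality for dominated gauge integrals\<close>

text \<open>
  The function \<open>h\<close> is only compared with a product of powers, so that neither the powers of \<open>u\<close> and
  \<open>w\<close> nor \<open>\<bar>h\<bar>\<close> have to be shown integrable. The proof integrates Young's inequality for \<open>u\<close> and \<open>w\<close>
  normalised by their integrals.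
\<close>
lemma Hoelder_dominated:
  fixes h u w :: "'a::euclidean_space \<Rightarrow> real"
  assumes pq: "p > 1" "q > 1" "1 / p + 1 / q = 1"
    and h: "h integrable_on S" and u: "u integrable_on S" and w: "w integrable_on S"
    and u0: "\<And>x. x \<in> S \<Longrightarrow> 0 \<le> u x" and w0: "\<And>x. x \<in> S \<Longrightarrow> 0 \<le> w x"
    and le: "\<And>x. x \<in> S \<Longrightarrow> \<bar>h x\<bar> \<le> u x powr (1 / p) * w x powr (1 / q)"
  shows "\<bar>integral S h\<bar> \<le> integral S u powr (1 / p) * integral S w powr (1 / q)"
proof -
  have U0: "0 \<le> integral S u" and W0: "0 \<le> integral S w"
    using u0 w0 by (auto intro!: integral_nonneg u w)
  \<comment> \<open>The shift by \<open>e\<close> allows division by integrals that may vanish.\<close>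
  have bound: "\<bar>integral S h\<bar> \<le> (integral S u + e) powr (1 / p) * (integral S w + e) powr (1 / q)"
    if e: "e > 0" for e
  proof -
    define U where "U = integral S u + e"
    define W where "W = integral S w + e"
    define C where "C = U powr (1 / p) * W powr (1 / q)"
    have UW: "U > 0" "W > 0" using U0 W0 e by (auto simp: U_def W_def)
    have C0: "C > 0" using UW by (simp add: C_def)
    have pt: "norm (h x) \<le> C / (p * U) * u x + C / (q * W) * w x" if x: "x \<in> S" for x
    proof -
      have "u x powr (1 / p) * w x powr (1 / q)
          = C * ((u x / U) powr (1 / p) * (w x / W) powr (1 / q))"
        using UW u0[OF x] w0[OF x] by (simp add: C_def powr_divide)
      also have "\<dots> \<le> C * (((u x / U) powr (1 / p)) powr p / p + ((w x / W) powr (1 / q)) powr q / q)"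
        using C0 pq by (intro mult_left_mono Youngs_inequality) auto
      also have "\<dots> = C / (p * U) * u x + C / (q * W) * w x"
        using UW u0[OF x] w0[OF x] pq by (simp add: powr_powr field_simps)
      finally show ?thesis using le[OF x] by simp
    qed
    have "norm (integral S h) \<le> integral S (\<lambda>x. C / (p * U) * u x + C / (q * W) * w x)"
      using pt by (intro integral_norm_bound_integral h integrable_add integrable_on_mult_right u w)
    also have "\<dots> = C * ((integral S u / U) / p + (integral S w / W) / q)"
    proof (rule integral_unique)
      have "((\<lambda>x. C / (p * U) * u x + C / (q * W) * w x) has_integral
          C / (p * U) * integral S u + C / (q * W) * integral S w) S"
        using u w by (intro has_integral_add has_integral_mult_right integrable_integral)
      then show "((\<lambda>x. C / (p * U) * u x + C / (q * W) * w x) has_integral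
          C * ((integral S u / U) / p + (integral S w / W) / q)) S"
        by (simp add: distrib_left mult.commute)
    qed
    also have "\<dots> \<le> C * (1 / p + 1 / q)"
      using C0 UW e pq by (intro mult_left_mono add_mono divide_right_mono) (auto simp: U_def W_def)
    finally show ?thesis using pq by (simp add: C_def U_def W_def)
  qed
  have "((\<lambda>e. (integral S u + e) powr (1 / p) * (integral S w + e) powr (1 / q))
      \<longlongrightarrow> (integral S u + 0) powr (1 / p) * (integral S w + 0) powr (1 / q)) (at_right 0)"
    using U0 W0 pq
    by (intro tendsto_mult tendsto_powr2 tendsto_intros eventually_at_right_less[THEN eventually_mono])
      auto
  moreover have "\<forall>\<^sub>F e in at_right 0.
      \<bar>integral S h\<bar> \<le> (integral S u + e) powr (1 / p) * (integral S w + e) powr (1 / q)"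
    using bound by (intro eventually_at_right_less[THEN eventually_mono]) auto
  ultimately show ?thesis
    using tendsto_lowerbound by fastforce
qed

section \<open>The trapezoidal error in the harmonic parameter\<close>

lemma harmonic_parameter_mem:
  fixes a b t :: real
  assumes "0 < a" "a < b" "t \<in> {0..1}"
  shows "a * b / (a + t * (b - a)) \<in> {a..b}"
proof -
  have "0 \<le> t * (b - a)" "t * (b - a) \<le> b - a"
    using assms by (auto intro: mult_left_le_one_le)
  then have A: "0 < a + t * (b - a)" "a + t * (b - a) \<le> b" "a \<le> a + t * (b - a)"
    using assms by linarith+
  have "a * (a + t * (b - a)) \<le> a * b" "b * a \<le> b * (a + t * (b - a))"
    using A assms by (intro mult_left_mono; linarith)+
  then show ?thesis
    using A(1) by (simp add: pos_le_divide_eq pos_divide_le_eq mult.commute)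
qed

lemma harmonic_parameter_substitution:
  fixes a b :: real
  assumes ab: "0 < a" "a < b" and f: "continuous_on {a..b} f"
  shows "((\<lambda>t. f (a * b / (a + t * (b - a)))) has_integral
    a * b / (b - a) * integral {a..b} (\<lambda>x. f x / x\<^sup>2)) {0..1}"
proof -
  define g where "g t = a * b / (a + t * (b - a))" for t
  define g' where "g' t = - (a * b * (b - a)) / (a + t * (b - a))\<^sup>2" for t
  have pos: "a + t * (b - a) > 0" if "t \<in> {0..1}" for t
    using that ab by (intro add_pos_nonneg) auto
  have dg: "(g has_field_derivative g' t) (at t within {0..1})" if t: "t \<in> {0..1}" for t
    using pos[OF t] unfolding g_def g'_def
    by (auto intro!: derivative_eq_intros simp: power2_eq_square field_simps)
  have "((\<lambda>t. g' t *\<^sub>R (f (g t) / (g t)\<^sup>2)) has_integral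
      integral {g 0..g 1} (\<lambda>x. f x / x\<^sup>2) - integral {g 1..g 0} (\<lambda>x. f x / x\<^sup>2)) {0..1}"
  proof (rule has_integral_substitution_general[where s = "{}" and c = a and d = b])
    show "g ` {0..1} \<subseteq> {a..b}"
      using harmonic_parameter_mem[OF ab] by (auto simp: g_def)
    show "continuous_on {a..b} (\<lambda>x. f x / x\<^sup>2)"
      using ab by (intro continuous_intros f) auto
    show "continuous_on {0..1} g"
      using dg by (rule DERIV_continuous_on)
  qed (use dg in auto)
  then have "((\<lambda>t. g' t *\<^sub>R (f (g t) / (g t)\<^sup>2)) has_integral
      - integral {a..b} (\<lambda>x. f x / x\<^sup>2)) {0..1}"
    using ab by (simp add: g_def)
  from has_integral_mult_right[OF this, of "- (a * b / (b - a))"]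
  have "((\<lambda>t. - (a * b / (b - a)) * (g' t *\<^sub>R (f (g t) / (g t)\<^sup>2))) has_integral
      a * b / (b - a) * integral {a..b} (\<lambda>x. f x / x\<^sup>2)) {0..1}"
    by simp
  moreover have "- (a * b / (b - a)) * (g' t *\<^sub>R (f (g t) / (g t)\<^sup>2)) = f (g t)"
    if t: "t \<in> {0..1}" for t
    using pos[OF t] ab by (simp add: g_def g'_def power_divide power2_eq_square)
  ultimately have "((\<lambda>t. f (g t)) has_integral
      a * b / (b - a) * integral {a..b} (\<lambda>x. f x / x\<^sup>2)) {0..1}"
    by (rule has_integral_eq[rotated])
  then show ?thesis by (simp add: g_def)
qed

text \<open>
  Integrability of the integrand is part of the conclusion: \<open>f'\<close> is a derivative everywhere on
  \<open>[a, b]\<close>, so the fundamental theorem for the gauge integral yields the integral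
  of the derivative of \<open>(1 - 2 * t) * f (a * b / (a + t * (b - a)))\<close>, and the part of it that does
  not involve \<open>f'\<close> is continuous.
\<close>
lemma harmonic_trapezoid_error:
  fixes a b :: real
  assumes ab: "0 < a" "a < b"
    and f: "\<And>x. x \<in> {a..b} \<Longrightarrow> (f has_real_derivative f' x) (at x)"
  shows "((\<lambda>t. (1 - 2 * t) * (f' (a * b / (a + t * (b - a))) / (a + t * (b - a))\<^sup>2)) has_integral
    2 / (a * b * (b - a)) *
      ((f a + f b) / 2 - a * b / (b - a) * integral {a..b} (\<lambda>x. f x / x\<^sup>2))) {0..1}"
proof -
  define g where "g t = a * b / (a + t * (b - a))" for t
  define g' where "g' t = - (a * b * (b - a)) / (a + t * (b - a))\<^sup>2" for t
  define J where "J = a * b / (b - a) * integral {a..b} (\<lambda>x. f x / x\<^sup>2)"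
  have pos: "a + t * (b - a) > 0" if "t \<in> {0..1}" for t
    using that ab by (intro add_pos_nonneg) auto
  have dg: "(g has_field_derivative g' t) (at t)" if t: "t \<in> {0..1}" for t
    using pos[OF t] unfolding g_def g'_def
    by (auto intro!: derivative_eq_intros simp: power2_eq_square field_simps)
  have dF: "((\<lambda>t. f (g t)) has_field_derivative f' (g t) * g' t) (at t)" if t: "t \<in> {0..1}" for t
    using DERIV_chain2[OF f dg[OF t]] harmonic_parameter_mem[OF ab t] by (simp add: g_def)
  have "((\<lambda>t. (1 - 2 * t) * (f' (g t) * g' t) - 2 * f (g t)) has_integral
      (1 - 2 * 1) * f (g 1) - (1 - 2 * 0) * f (g 0)) {0..1}"
  proof (rule fundamental_theorem_of_calculus)
    fix t :: real assume t: "t \<in> {0..1}"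
    have "((\<lambda>t. (1 - 2 * t) * f (g t)) has_field_derivative
        (1 - 2 * t) * (f' (g t) * g' t) - 2 * f (g t)) (at t)"
      by (auto intro!: derivative_eq_intros dF[OF t])
    then show "((\<lambda>t. (1 - 2 * t) * f (g t)) has_vector_derivative
        (1 - 2 * t) * (f' (g t) * g' t) - 2 * f (g t)) (at t within {0..1})"
      by (simp add: has_real_derivative_iff_has_vector_derivative has_vector_derivative_at_within)
  qed simp
  moreover have "((\<lambda>t. f (g t)) has_integral J) {0..1}"
    unfolding g_def J_def using f by (intro harmonic_parameter_substitution ab DERIV_continuous_on)
      (auto intro: has_field_derivative_at_within)
  ultimately have "((\<lambda>t. ((1 - 2 * t) * (f' (g t) * g' t) - 2 * f (g t)) + 2 * f (g t)) has_integral
      ((1 - 2 * 1) * f (g 1) - (1 - 2 * 0) * f (g 0)) + 2 * J) {0..1}"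
    by (intro has_integral_add has_integral_mult_right)
  then have "((\<lambda>t. (1 - 2 * t) * (f' (g t) * g' t)) has_integral 2 * J - f a - f b) {0..1}"
    using ab by (simp add: g_def algebra_simps)
  from has_integral_mult_right[OF this, of "- 1 / (a * b * (b - a))"]
  have "((\<lambda>t. - 1 / (a * b * (b - a)) * ((1 - 2 * t) * (f' (g t) * g' t))) has_integral
      - 1 / (a * b * (b - a)) * (2 * J - f a - f b)) {0..1}" .
  moreover have "- 1 / (a * b * (b - a)) * ((1 - 2 * t) * (f' (g t) * g' t))
      = (1 - 2 * t) * (f' (g t) / (a + t * (b - a))\<^sup>2)" for t
    using ab by (simp add: g'_def)
  moreover have "- 1 / (a * b * (b - a)) * (2 * J - f a - f b)
      = 2 / (a * b * (b - a)) * ((f a + f b) / 2 - J)"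
    using ab by (simp add: field_simps)
  ultimately show ?thesis by (simp add: g_def J_def)
qed

section \<open>The two factors\<close>

lemma trapezoid_kernel_has_integral:
  fixes p :: real
  assumes "p > 0"
  shows "((\<lambda>t. \<bar>1 - 2 * t\<bar> powr p) has_integral 1 / (p + 1)) {0..1}"
proof -
  define G where "G t = (2 * t - 1) * \<bar>1 - 2 * t\<bar> powr p / (2 * (p + 1))" for t :: real
  have "((\<lambda>t. \<bar>1 - 2 * t\<bar> powr p) has_integral G 1 - G 0) {0..1}"
  proof (rule fundamental_theorem_of_calculus_interior_strong[where S = "{1/2}"])
    show "continuous_on {0..1} G"
      unfolding G_def using assms by (intro continuous_intros continuous_on_powr') auto
    fix t :: real assume t: "t \<in> {0<..<1} - {1/2}"
    have ne: "1 - 2 * t \<noteq> 0" using t by auto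
    then have "(abs has_real_derivative sgn (1 - 2 * t)) (at (1 - 2 * t))"
      using has_derivative_norm[of "1 - 2 * t"] unfolding has_field_derivative_def real_norm_def
      by (simp add: mult.commute[of _ "sgn _"])
    moreover have "((\<lambda>t. 1 - 2 * t) has_real_derivative - 2) (at t)"
      by (auto intro!: derivative_eq_intros)
    ultimately have "((\<lambda>t. \<bar>1 - 2 * t\<bar>) has_real_derivative sgn (1 - 2 * t) * (- 2)) (at t)"
      by (rule DERIV_chain2)
    from DERIV_chain2[where f = "\<lambda>x. x powr p", OF has_real_derivative_powr this]
    have "((\<lambda>t. \<bar>1 - 2 * t\<bar> powr p) has_real_derivative
        p * \<bar>1 - 2 * t\<bar> powr (p - 1) * (sgn (1 - 2 * t) * (- 2))) (at t)"
      using ne by simp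
    moreover have "((\<lambda>t. 2 * t - 1) has_real_derivative 2) (at t)"
      by (auto intro!: derivative_eq_intros)
    ultimately have "(G has_real_derivative (2 * \<bar>1 - 2 * t\<bar> powr p
        + p * \<bar>1 - 2 * t\<bar> powr (p - 1) * (sgn (1 - 2 * t) * (- 2)) * (2 * t - 1)) / (2 * (p + 1))) (at t)"
      unfolding G_def by (intro DERIV_cdivide DERIV_mult[THEN DERIV_cong]) auto
    moreover have "2 * \<bar>1 - 2 * t\<bar> powr p
        + p * \<bar>1 - 2 * t\<bar> powr (p - 1) * (sgn (1 - 2 * t) * (- 2)) * (2 * t - 1)
        = 2 * (p + 1) * \<bar>1 - 2 * t\<bar> powr p"
    proof -
      have "\<bar>1 - 2 * t\<bar> powr (p - 1) * (sgn (1 - 2 * t) * (1 - 2 * t)) = \<bar>1 - 2 * t\<bar> powr p"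
        using t by (simp add: powr_diff abs_sgn[symmetric] mult.commute[of "sgn _"])
      moreover have "p * \<bar>1 - 2 * t\<bar> powr (p - 1) * (sgn (1 - 2 * t) * (- 2)) * (2 * t - 1)
          = 2 * p * (\<bar>1 - 2 * t\<bar> powr (p - 1) * (sgn (1 - 2 * t) * (1 - 2 * t)))"
        by (simp add: algebra_simps)
      ultimately have "p * \<bar>1 - 2 * t\<bar> powr (p - 1) * (sgn (1 - 2 * t) * (- 2)) * (2 * t - 1)
          = 2 * p * \<bar>1 - 2 * t\<bar> powr p"
        by (simp only:)
      then show ?thesis by (simp only: distrib_left distrib_right)
    qed
    ultimately have "(G has_real_derivative \<bar>1 - 2 * t\<bar> powr p) (at t)"
      using assms by simp
    then show "(G has_vector_derivative \<bar>1 - 2 * t\<bar> powr p) (at t)"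
      by (simp add: has_real_derivative_iff_has_vector_derivative)
  qed auto
  moreover have "G 1 - G 0 = 1 / (p + 1)"
    using assms by (simp add: G_def field_simps)
  ultimately show ?thesis by simp
qed

text \<open>
  The Beta factors cancel, and \<open>b powr - (2 * q)\<close> times the last factor of the Euler integral is
  \<open>(b - (b - a) * t) powr - (2 * q)\<close>, which is the stated weight at \<open>1 - t\<close>.
\<close>
lemma nu_has_integral:
  fixes a b \<alpha> q :: real
  assumes ab: "0 < a" "a < b" and \<alpha>: "0 \<le> \<alpha>"
  shows "((\<lambda>t. rpow t \<alpha> * (a + t * (b - a)) powr (- (2 * q))) has_integral nu \<alpha> q a b) {0..1}"
proof -
  define k where "k t = rpow t \<alpha> * (a + t * (b - a)) powr (- (2 * q))" for t
  have pos: "a + t * (b - a) > 0" if "t \<in> {0..1}" for t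
    using that ab by (intro add_pos_nonneg) auto
  have "continuous_on {0..1} (\<lambda>t. rpow t \<alpha>)"
    using \<alpha> by (cases "\<alpha> = 0") (auto simp: rpow_def intro!: continuous_intros continuous_on_powr')
  moreover have "continuous_on {0..1} (\<lambda>t. (a + t * (b - a)) powr (- (2 * q)))"
    using pos by (intro continuous_intros continuous_on_powr) force+
  ultimately have "k integrable_on {0..1}"
    unfolding k_def by (intro integrable_continuous_real continuous_on_mult)
  then have k: "(k has_integral integral {0..1} k) {0..1}" by blast
  have "((\<lambda>t. k (1 - t)) has_integral integral {0..1} k) {0..1}"
    using has_integral_affinity[of k _ 0 1 "- 1" 1] k by (simp add: image_affinity_atLeastAtMost)
  then have "integral {0..1} (\<lambda>t. k (1 - t)) = integral {0..1} k" by blast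
  \<comment> \<open>At the end points a factor \<open>0 powr 0 = 0\<close> can spoil the identity of the integrands.\<close>
  moreover have "integral {0..1} (\<lambda>t. t powr (1 - 1) * (1 - t) powr (\<alpha> + 2 - 1 - 1)
      * (1 - (1 - a / b) * t) powr (- (2 * q)))
    = integral {0..1} (\<lambda>t. b powr (2 * q) * k (1 - t))"
  proof (rule integral_spike)
    show "negligible {0, 1::real}" by simp
    fix t :: real assume t: "t \<in> {0..1} - {0, 1}"
    have eq: "1 - (1 - a / b) * t = (a + (1 - t) * (b - a)) / b"
      using ab by (simp add: field_simps)
    have "a + (1 - t) * (b - a) > 0" using t by (intro pos) auto
    then show "b powr (2 * q) * k (1 - t) = t powr (1 - 1) * (1 - t) powr (\<alpha> + 2 - 1 - 1)
        * (1 - (1 - a / b) * t) powr (- (2 * q))"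
      unfolding eq using t ab by (simp add: k_def rpow_def powr_divide powr_minus field_simps)
  qed
  moreover have "Gamma (\<alpha> + 1) > 0" "Gamma (1 + (\<alpha> + 1)) > 0"
    using \<alpha> by (auto intro!: Gamma_real_pos)
  then have "Beta 1 (\<alpha> + 1) \<noteq> 0"
    by (simp add: Beta_def)
  ultimately have "nu \<alpha> q a b = integral {0..1} k"
    using ab by (simp add: nu_def hypergeom_2F1_def add.commute)
  then show ?thesis using k by (simp add: k_def[abs_def])
qed

text \<open>
  The second convexity point is \<open>b / m\<close> because the factor \<open>m\<close> in the argument of \<open>g\<close>
  then cancels.
\<close>
lemma harmonically_convex_on_le:
  fixes a b m t \<alpha> :: real
  assumes "harmonically_convex_on \<alpha> m {a..b / m} g"
    and "0 < m" "m \<le> 1" "0 < a" "a < b" "t \<in> {0..1}"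
  shows "g (a * b / (a + t * (b - a))) \<le> rpow t \<alpha> * g a + m * (1 - rpow t \<alpha>) * g (b / m)"
proof -
  have "b * m \<le> b * 1" using assms by (intro mult_left_mono) auto
  then have "a * m \<le> b" using assms mult_right_mono[of a b m] by linarith
  then have "a \<le> b / m" using assms by (simp add: pos_le_divide_eq)
  then have "g (m * a * (b / m) / (m * t * (b / m) + (1 - t) * a))
      \<le> rpow t \<alpha> * g a + m * (1 - rpow t \<alpha>) * g (b / m)"
    using assms unfolding harmonically_convex_on_def by fastforce
  moreover have "m * a * (b / m) / (m * t * (b / m) + (1 - t) * a) = a * b / (a + t * (b - a))"
    using assms by (simp add: algebra_simps)
  ultimately show ?thesis by simp
qed

section \<open>The trapezoid inequality\<close>

theorem theorem7:
  fixes I :: "real set" and f f' :: "real \<Rightarrow> real" and a b m \<alpha> p q :: real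
  assumes "is_interval I" and "I \<subseteq> {0<..}"
    and "\<And>x. x \<in> interior I \<Longrightarrow> (f has_real_derivative f' x) (at x)"
    and "0 < m" and "m \<le> 1"
    and "a \<in> interior I" and "b / m \<in> interior I" and "a < b"
    and "f' absolutely_integrable_on {a..b}"
    and "q > 1" and "1 / p + 1 / q = 1"
    and "0 \<le> \<alpha>" and "\<alpha> \<le> 1"
    and "harmonically_convex_on \<alpha> m {a..b / m} (\<lambda>x. \<bar>f' x\<bar> powr q)"
  shows "\<bar>(f a + f b) / 2 - a * b / (b - a) * integral {a..b} (\<lambda>x. f x / x\<^sup>2)\<bar>
    \<le> a * b * (b - a) / 2 * (1 / (p + 1)) powr (1 / p) *
      (nu \<alpha> q a b * \<bar>f' a\<bar> powr q
        + m * (nu 0 q a b - nu \<alpha> q a b) * \<bar>f' (b / m)\<bar> powr q) powr (1 / q)"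
proof -
  have ab: "0 < a" "a < b"
    using assms(2,6,8) interior_subset by auto
  have p: "p > 1"
  proof -
    have "1 / p = 1 - 1 / q" using assms(11) by simp
    then have "0 < 1 / p" "1 / p < 1" using assms(10) by auto
    then show ?thesis by (simp add: divide_less_eq split: if_splits)
  qed
  have "b * m \<le> b * 1" using assms ab by (intro mult_left_mono) auto
  then have "b \<le> b / m" using assms by (simp add: field_simps)
  moreover have "is_interval (interior I)"
    using assms(1) by (simp add: is_interval_convex_1 convex_interior)
  ultimately have sub: "x \<in> interior I" if "x \<in> {a..b}" for x
    using that assms(6,7) by (meson atLeastAtMost_iff is_interval_1 order_trans)
  define A where "A t = a + t * (b - a)" for t
  define X where "X = \<bar>f' a\<bar> powr q"
  define Y where "Y = \<bar>f' (b / m)\<bar> powr q"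
  define E where "E = (f a + f b) / 2 - a * b / (b - a) * integral {a..b} (\<lambda>x. f x / x\<^sup>2)"
  define h where "h t = (1 - 2 * t) * (f' (a * b / A t) / (A t)\<^sup>2)" for t
  define w where "w t = (rpow t \<alpha> * X + m * (1 - rpow t \<alpha>) * Y) * A t powr (- (2 * q))" for t
  have h: "(h has_integral 2 / (a * b * (b - a)) * E) {0..1}"
    unfolding h_def A_def E_def using sub assms(3) by (intro harmonic_trapezoid_error ab) auto
  have "((\<lambda>t. (rpow t \<alpha> * A t powr (- (2 * q))) * X
        + m * (rpow t 0 * A t powr (- (2 * q)) - rpow t \<alpha> * A t powr (- (2 * q))) * Y)
      has_integral nu \<alpha> q a b * X + m * (nu 0 q a b - nu \<alpha> q a b) * Y) {0..1}"
    unfolding A_def using assms ab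
    by (intro has_integral_add has_integral_diff has_integral_mult_left has_integral_mult_right
        nu_has_integral) auto
  then have w: "(w has_integral nu \<alpha> q a b * X + m * (nu 0 q a b - nu \<alpha> q a b) * Y) {0..1}"
    by (rule has_integral_eq[rotated]) (simp add: w_def rpow_def algebra_simps)
  have u: "((\<lambda>t. \<bar>1 - 2 * t\<bar> powr p) has_integral 1 / (p + 1)) {0..1}"
    using p by (intro trapezoid_kernel_has_integral) auto
  have "\<bar>integral {0..1} h\<bar>
      \<le> integral {0..1} (\<lambda>t. \<bar>1 - 2 * t\<bar> powr p) powr (1 / p) * integral {0..1} w powr (1 / q)"
  proof (rule Hoelder_dominated[OF p assms(10,11)])
    fix t :: real assume t: "t \<in> {0..1}"
    have A0: "A t > 0" using t ab by (auto simp: A_def intro!: add_pos_nonneg)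
    have "0 \<le> rpow t \<alpha>" "rpow t \<alpha> \<le> 1"
      using t assms(12) by (auto simp: rpow_def intro: powr_le1)
    then show "0 \<le> w t"
      using assms(4) by (simp add: w_def X_def Y_def)
    have "(\<bar>f' (a * b / A t)\<bar> powr q * A t powr (- (2 * q))) powr (1 / q) = \<bar>f' (a * b / A t)\<bar> * A t powr (- 2)"
      using assms(10) A0 by (simp add: powr_mult powr_powr)
    also have "\<dots> = \<bar>f' (a * b / A t)\<bar> / (A t)\<^sup>2"
      using A0 by (simp add: powr_minus powr_numeral divide_inverse)
    finally have "\<bar>h t\<bar> = (\<bar>1 - 2 * t\<bar> powr p) powr (1 / p)
        * (\<bar>f' (a * b / A t)\<bar> powr q * A t powr (- (2 * q))) powr (1 / q)"
      using p by (simp add: h_def abs_mult powr_powr)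
    also have "\<dots> \<le> (\<bar>1 - 2 * t\<bar> powr p) powr (1 / p) * w t powr (1 / q)"
      unfolding w_def X_def Y_def A_def
      using harmonically_convex_on_le[OF assms(14,4,5) ab t] assms(10)
      by (intro mult_left_mono powr_mono2 mult_right_mono) auto
    finally show "\<bar>h t\<bar> \<le> (\<bar>1 - 2 * t\<bar> powr p) powr (1 / p) * w t powr (1 / q)" .
  qed (use h u w in auto)
  then have "2 / (a * b * (b - a)) * \<bar>E\<bar> \<le> (1 / (p + 1)) powr (1 / p)
      * (nu \<alpha> q a b * X + m * (nu 0 q a b - nu \<alpha> q a b) * Y) powr (1 / q)"
    using ab unfolding integral_unique[OF h] integral_unique[OF u] integral_unique[OF w]
    by (simp add: abs_mult)
  then have "a * b * (b - a) / 2 * (2 / (a * b * (b - a)) * \<bar>E\<bar>) \<le> a * b * (b - a) / 2 * ((1 / (p + 1)) powr (1 / p)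
      * (nu \<alpha> q a b * X + m * (nu 0 q a b - nu \<alpha> q a b) * Y) powr (1 / q))"
    using ab by (intro mult_left_mono) auto
  moreover have "a * b * (b - a) / 2 * (2 / (a * b * (b - a)) * \<bar>E\<bar>) = \<bar>E\<bar>"
    using ab by simp
  ultimately show ?thesis
    by (simp add: E_def X_def Y_def mult.assoc)
qed

end
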